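(* Let $a=\sqrt{\dfrac{2}{1+\sqrt2}}$ and let $\Omega\subset\mathbb{C}\cong\mathbb{R}^2$ be the interior of the Neumann oval region $$\{(x,y)\in\mathbb{R}^2:\ (x^2+y^2)^2\le a^2(x^2+y^2)+4x^2\}.$$ Then the torsion function $v$ of $\Omega$ has a unique maximum, which occurs at $z=0$, and the Hessian matrix $H$ of $v$ at $0$ has rank one and is given by $$H=\begin{pmatrix}0&0\\0&-2\end{pmatrix}.$$
   Context: The torsion function of a bounded simply-connected domain $\Omega\subset\mathbb{C}$ is the solution $v$ of $\Delta v=-2$ in $\Omega$, $v=0$ on $\partial\Omega$. The Hessian is taken with respect to the real coordinates $(x,y)$, $z=x+iy$. A maximum of $v$ means a point of $\Omega$ where $v$ attains a local maximum. *)

theory Defs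
  imports "HOL-Analysis.Analysis"
begin

text \<open>
  The plane is the type \<^typ>\<open>complex\<close>, whose orthonormal basis consists of \<open>1\<close> (the
  \<open>x\<close>-direction) and \<open>\<i>\<close> (the \<open>y\<close>-direction).  Derivatives are always derivatives
  over the reals.
\<close>

definition partial_deriv :: "complex \<Rightarrow> (complex \<Rightarrow> real) \<Rightarrow> complex \<Rightarrow> real" where
  "partial_deriv d f z = frechet_derivative f (at z) d"

text \<open>
  \<^const>\<open>frechet_derivative\<close> is unspecified where the function is not differentiable, so
  \<^const>\<open>partial_deriv\<close> and everything built from it is meaningful only together with the
  following regularity condition, which is intended for open \<open>S\<close>.
\<close>

definition C2_on :: "(complex \<Rightarrow> real) \<Rightarrow> complex set \<Rightarrow> bool" where
  "C2_on f S \<longleftrightarrow>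
     (\<forall>z\<in>S. f differentiable (at z)) \<and>
     (\<forall>d\<in>{1, \<i>}. \<forall>z\<in>S. partial_deriv d f differentiable (at z)) \<and>
     (\<forall>d\<in>{1, \<i>}. \<forall>e\<in>{1, \<i>}. continuous_on S (partial_deriv e (partial_deriv d f)))"

definition laplacian :: "(complex \<Rightarrow> real) \<Rightarrow> complex \<Rightarrow> real" where
  "laplacian f z =
     partial_deriv 1 (partial_deriv 1 f) z + partial_deriv \<i> (partial_deriv \<i> f) z"

definition hessian :: "(complex \<Rightarrow> real) \<Rightarrow> complex \<Rightarrow> real ^ 2 ^ 2" where
  "hessian f z = vector
     [vector [partial_deriv 1 (partial_deriv 1 f) z, partial_deriv 1 (partial_deriv \<i> f) z],
      vector [partial_deriv \<i> (partial_deriv 1 f) z, partial_deriv \<i> (partial_deriv \<i> f) z]]"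

text \<open>
  Classical solutions of the torsion problem.  Values of \<open>v\<close> outside the closure of
  \<open>\<Omega>\<close> are irrelevant.
\<close>

definition torsion_function :: "complex set \<Rightarrow> (complex \<Rightarrow> real) \<Rightarrow> bool" where
  "torsion_function \<Omega> v \<longleftrightarrow>
     C2_on v \<Omega> \<and> continuous_on (closure \<Omega>) v \<and>
     (\<forall>z\<in>\<Omega>. laplacian v z = -2) \<and> (\<forall>z\<in>frontier \<Omega>. v z = 0)"

text \<open>
  Neighbourhoods are those of the plane; for open \<open>\<Omega>\<close> this is the same as comparing only with
  nearby points of \<open>\<Omega>\<close>.
\<close>

definition local_maxima :: "complex set \<Rightarrow> (complex \<Rightarrow> real) \<Rightarrow> complex set" where
  "local_maxima \<Omega> v = {z \<in> \<Omega>. \<forall>\<^sub>F w in nhds z. v w \<le> v z}"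

definition neumann_oval_region :: "real \<Rightarrow> complex set" where
  "neumann_oval_region a =
     {z. ((Re z)\<^sup>2 + (Im z)\<^sup>2)\<^sup>2 \<le> a\<^sup>2 * ((Re z)\<^sup>2 + (Im z)\<^sup>2) + 4 * (Re z)\<^sup>2}"

end

theory Submission
  imports Defs
begin

text \<open>
  The torsion function of this oval is elementary: it is
  \<open>Re (sqrt (1 + z\<^sup>2)) - |z|\<^sup>2 / 2\<close>, with the root in the right half-plane.  Away from the slits
  \<open>{i y. |y| \<ge> 1}\<close> of the root, which the oval does not meet, the first summand is harmonic and the
  second has Laplacian \<open>-2\<close>.  What makes it the torsion function is the boundary condition
  (\<open>oval_torsion_eq_0\<close>).  For any \<open>a > 0\<close>, put \<open>K\<^sup>2 = a\<^sup>2 (a\<^sup>2 + 4)\<close>; then on the curve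
  \<open>|z|\<^sup>4 = a\<^sup>2 |z|\<^sup>2 + 4 x\<^sup>2\<close>, apart from its isolated point \<open>0\<close>, the modulus of \<open>1 + 4 z\<^sup>2 / K\<^sup>2\<close> is
  an affine function of \<open>|z|\<^sup>2\<close>, and the half-angle formula turns this into
  \<open>|z|\<^sup>2 = K Re (sqrt (1 + 4 z\<^sup>2 / K\<^sup>2))\<close>.  So the torsion function is
  \<open>(K / 2) Re (sqrt (1 + 4 z\<^sup>2 / K\<^sup>2)) - |z|\<^sup>2 / 2\<close>, and its expansion
  \<open>K / 2 + Re (z\<^sup>2) / K - |z|\<^sup>2 / 2 + ...\<close> at \<open>0\<close> loses its \<open>x\<^sup>2\<close> term exactly when \<open>K = 2\<close>.  The
  given \<open>a\<close> is the positive solution of \<open>a\<^sup>2 (a\<^sup>2 + 4) = 4\<close>, that is, of \<open>(a\<^sup>2 + 2)\<^sup>2 = 8\<close>.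

  A classical solution of the Dirichlet problem is unique by the maximum principle
  (\<open>comparison_principle\<close>, \<open>torsion_function_unique\<close>), so every torsion function \<open>v\<close> agrees with the
  explicit one on \<open>\<Omega>\<close> and the Hessian at \<open>0\<close> can be read off.  Since that Hessian is degenerate,
  it does not decide whether \<open>0\<close> is a maximum.  Two direct arguments replace it: the gradient of the
  explicit function vanishes only at \<open>0\<close> (\<open>oval_torsion_critical_point\<close>), and with
  \<open>s = sqrt (1 + z\<^sup>2)\<close> the value at \<open>0\<close> is the global maximum because
  \<open>|z|\<^sup>2 = |s - 1| |s + 1| \<ge> 2 (Re s - 1)\<close> (\<open>oval_torsion_le\<close>).
\<close>

section \<open>Partial derivatives and the Laplacian\<close>

lemma partial_deriv_eq:
  assumes "(f has_derivative D) (at z)"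
  shows "partial_deriv d f z = D d"
  using frechet_derivative_at[OF assms] by (simp add: partial_deriv_def)

lemma partial_deriv_cong_open:
  assumes S: "open S" "z \<in> S" and eq: "\<And>w. w \<in> S \<Longrightarrow> f w = g w"
  shows "partial_deriv d f z = partial_deriv d g z"
proof -
  have "(f has_derivative D) (at z) \<longleftrightarrow> (g has_derivative D) (at z)" for D
    using has_derivative_transform_within_open[OF _ S] eq by metis
  then show ?thesis by (simp add: partial_deriv_def frechet_derivative_def)
qed

lemma partial_deriv_add_cmult:
  assumes "f differentiable (at z)" "g differentiable (at z)"
  shows "partial_deriv d (\<lambda>w. f w + c * g w) z = partial_deriv d f z + c * partial_deriv d g z"
proof -
  have "((\<lambda>w. f w + c * g w) has_derivative
      (\<lambda>h. frechet_derivative f (at z) h + c * frechet_derivative g (at z) h)) (at z)"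
    by (intro derivative_intros assms[unfolded frechet_derivative_works])
  then show ?thesis using partial_deriv_eq by (fastforce simp: partial_deriv_def)
qed

text \<open>
  The regularity that a comparison of pure second derivatives at a single point calls for.
\<close>

definition twice_differentiable_on :: "(complex \<Rightarrow> real) \<Rightarrow> complex set \<Rightarrow> bool" where
  "twice_differentiable_on f S \<longleftrightarrow>
     (\<forall>z\<in>S. f differentiable (at z)) \<and>
     (\<forall>d\<in>{1, \<i>}. \<forall>z\<in>S. partial_deriv d f differentiable (at z))"

lemma twice_differentiable_on_add_cmult:
  assumes S: "open S" and f: "twice_differentiable_on f S" and g: "twice_differentiable_on g S"
  shows "twice_differentiable_on (\<lambda>w. f w + c * g w) S"
    and "z \<in> S \<Longrightarrow> laplacian (\<lambda>w. f w + c * g w) z = laplacian f z + c * laplacian g z"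
proof -
  let ?h = "\<lambda>w. f w + c * g w"
  have first: "partial_deriv d f w + c * partial_deriv d g w = partial_deriv d ?h w"
    if "w \<in> S" for d w
    using that f g by (simp add: twice_differentiable_on_def partial_deriv_add_cmult)
  have "(\<lambda>w. partial_deriv d f w + c * partial_deriv d g w) differentiable (at z)"
    if "z \<in> S" "d \<in> {1, \<i>}" for d z
    using that f g unfolding twice_differentiable_on_def
    by (intro differentiable_add differentiable_mult differentiable_const) auto
  then have "partial_deriv d ?h differentiable (at z)" if "z \<in> S" "d \<in> {1, \<i>}" for d z
    using that first S unfolding differentiable_def
    by (metis (no_types, lifting) has_derivative_transform_within_open)
  moreover have "?h differentiable (at z)" if "z \<in> S" for z
    using that f g unfolding twice_differentiable_on_def
    by (intro differentiable_add differentiable_mult differentiable_const) auto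
  ultimately show "twice_differentiable_on ?h S"
    unfolding twice_differentiable_on_def by blast
  have "partial_deriv d (partial_deriv d ?h) z =
      partial_deriv d (partial_deriv d f) z + c * partial_deriv d (partial_deriv d g) z"
    if "z \<in> S" "d \<in> {1, \<i>}" for d z
  proof -
    have "partial_deriv d (partial_deriv d ?h) z =
        partial_deriv d (\<lambda>w. partial_deriv d f w + c * partial_deriv d g w) z"
      by (rule partial_deriv_cong_open[OF S \<open>z \<in> S\<close> first[symmetric]])
    also have "\<dots> = partial_deriv d (partial_deriv d f) z + c * partial_deriv d (partial_deriv d g) z"
      using that f g by (intro partial_deriv_add_cmult) (auto simp: twice_differentiable_on_def)
    finally show ?thesis .
  qed
  then show "laplacian ?h z = laplacian f z + c * laplacian g z" if "z \<in> S"
    using that by (simp add: laplacian_def algebra_simps)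
qed

text \<open>
  One computation serves two functions: the explicit torsion function (\<open>c = -1/2\<close>) and, with
  \<open>F = 0\<close> and \<open>c = 1\<close>, the perturbation \<open>|z|\<^sup>2\<close> in the maximum principle.  The Laplacian is \<open>4 * c\<close>
  because \<open>F''\<close> enters the two pure second derivatives with the factors \<open>1\<close> and \<open>\<i>\<^sup>2 = -1\<close>.
\<close>

lemma derivatives_Re_plus_norm_square:
  fixes c :: real
  defines "u \<equiv> \<lambda>F w. Re (F w) + c * (norm w)\<^sup>2"
  assumes S: "open S"
    and F: "\<And>z. z \<in> S \<Longrightarrow> (F has_field_derivative F' z) (at z)"
    and F': "\<And>z. z \<in> S \<Longrightarrow> (F' has_field_derivative F'' z) (at z)"
  shows "z \<in> S \<Longrightarrow> (u F has_derivative (\<lambda>h. Re (F' z * h) + 2 * c * (z \<bullet> h))) (at z)"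
    and "twice_differentiable_on (u F) S"
    and "z \<in> S \<Longrightarrow> partial_deriv e (partial_deriv d (u F)) z = Re (F'' z * e * d) + 2 * c * (e \<bullet> d)"
    and "z \<in> S \<Longrightarrow> laplacian (u F) z = 4 * c"
proof -
  have D1: "(u F has_derivative (\<lambda>h. Re (F' z * h) + 2 * c * (z \<bullet> h))) (at z)"
    if "z \<in> S" for z
    unfolding u_def power2_norm_eq_inner
    by (rule derivative_eq_intros has_derivative_Re
        F[OF that, unfolded has_field_derivative_def] refl | simp)+
       (auto simp: fun_eq_iff inner_commute algebra_simps)
  have D2: "(partial_deriv d (u F) has_derivative (\<lambda>h. Re (F'' z * h * d) + 2 * c * (h \<bullet> d))) (at z)"
    if "z \<in> S" for d z
  proof (rule has_derivative_transform_within_open[OF _ S that])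
    show "((\<lambda>w. Re (F' w * d) + 2 * c * (w \<bullet> d)) has_derivative
        (\<lambda>h. Re (F'' z * h * d) + 2 * c * (h \<bullet> d))) (at z)"
      by (rule derivative_eq_intros has_derivative_Re
          F'[OF that, unfolded has_field_derivative_def] refl | simp)+
  qed (simp add: partial_deriv_eq[OF D1])
  show "twice_differentiable_on (u F) S"
    using D1 D2 unfolding twice_differentiable_on_def differentiable_def by blast
  show "z \<in> S \<Longrightarrow> (u F has_derivative (\<lambda>h. Re (F' z * h) + 2 * c * (z \<bullet> h))) (at z)"
    by (fact D1)
  show second: "partial_deriv e (partial_deriv d (u F)) z = Re (F'' z * e * d) + 2 * c * (e \<bullet> d)"
    if "z \<in> S" for d e
    using D2[OF that] by (rule partial_deriv_eq)
  show "laplacian (u F) z = 4 * c" if "z \<in> S"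
    using that by (simp add: laplacian_def second inner_complex_def)
qed

section \<open>The comparison principle\<close>

text \<open>
  If \<open>c > 0\<close>, then \<open>g'\<close> is positive just to the right of its zero at the maximum, so \<open>g\<close> would
  increase there.
\<close>

lemma second_derivative_nonpos_at_local_max:
  fixes g g' :: "real \<Rightarrow> real"
  assumes r: "r > 0"
    and g: "\<And>t. \<bar>t\<bar> < r \<Longrightarrow> (g has_real_derivative g' t) (at t)"
    and g': "(g' has_real_derivative c) (at 0)"
    and max: "\<And>t. \<bar>t\<bar> < r \<Longrightarrow> g t \<le> g 0"
  shows "c \<le> 0"
proof (rule ccontr)
  assume "\<not> c \<le> 0"
  then obtain \<delta> where \<delta>: "\<delta> > 0" "\<And>h. 0 < h \<Longrightarrow> h < \<delta> \<Longrightarrow> g' 0 < g' h"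
    using has_real_derivative_pos_inc_right[OF g'] by auto
  have "g' 0 = 0"
    by (rule DERIV_local_max[OF g, of 0 r]) (use r max in auto)
  define t where "t = min r \<delta> / 2"
  have t: "0 < t" "t < r" "t < \<delta>"
    using r \<delta> by (auto simp: t_def min_def)
  have "g 0 < g t"
  proof (rule DERIV_pos_imp_increasing_open[OF \<open>0 < t\<close>])
    show "\<exists>y. DERIV g x :> y \<and> 0 < y" if "0 < x" "x < t" for x
      using g[of x] \<delta>(2)[of x] that t \<open>g' 0 = 0\<close> by auto
    show "continuous_on {0..t} g"
      using t by (intro continuous_at_imp_continuous_on ballI DERIV_isCont[OF g]) auto
  qed
  with max[of t] t show False by auto
qed

text \<open>
  Restricting to the line through \<open>z\<close> in direction \<open>d\<close> reduces this to one variable.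
\<close>

lemma pure_second_partial_nonpos_at_local_max:
  assumes S: "open S" "z \<in> S" and f: "\<And>w. w \<in> S \<Longrightarrow> f differentiable (at w)"
    and f': "partial_deriv d f differentiable (at z)"
    and max: "\<And>w. w \<in> S \<Longrightarrow> f w \<le> f z"
  shows "partial_deriv d (partial_deriv d f) z \<le> 0"
proof -
  let ?l = "\<lambda>t. z + of_real t * d"
  have slice: "((\<lambda>s. f (?l s)) has_real_derivative partial_deriv d f (?l t)) (at t)"
    if "f differentiable (at (?l t))" for f t
  proof -
    have l: "(?l has_derivative (\<lambda>s. of_real s * d)) (at t)"
      by (rule derivative_eq_intros refl | simp)+
    have lin: "linear (frechet_derivative f (at (?l t)))"
      using that by (rule linear_frechet_derivative)
    have "((\<lambda>s. f (?l s)) has_derivative (\<lambda>s. frechet_derivative f (at (?l t)) (of_real s * d))) (at t)"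
      using has_derivative_compose[OF l, of f] that frechet_derivative_works by blast
    then show ?thesis
      using linear_scale[OF lin]
      by (simp add: has_field_derivative_def partial_deriv_def scaleR_conv_of_real[symmetric]
          mult_commute_abs)
  qed
  have "open (?l -` S)"
    by (intro open_vimage S(1) continuous_intros)
  moreover have "0 \<in> ?l -` S" using S(2) by simp
  ultimately obtain r where r: "r > 0" "ball 0 r \<subseteq> ?l -` S"
    by (meson openE)
  then have r_S: "?l t \<in> S" if "\<bar>t\<bar> < r" for t
    using that by (auto simp: subset_iff)
  show ?thesis
  proof (rule second_derivative_nonpos_at_local_max[OF \<open>r > 0\<close>])
    show "((\<lambda>s. f (?l s)) has_real_derivative partial_deriv d f (?l t)) (at t)" if "\<bar>t\<bar> < r" for t
      using that by (intro slice f r_S)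
    show "((\<lambda>s. partial_deriv d f (?l s)) has_real_derivative partial_deriv d (partial_deriv d f) z) (at 0)"
      using slice[of "partial_deriv d f" 0] f' by simp
    show "f (?l t) \<le> f (?l 0)" if "\<bar>t\<bar> < r" for t
      using max[OF r_S[OF that]] by simp
  qed
qed

text \<open>
  If \<open>f - g\<close> were positive somewhere, adding a small multiple of \<open>|z|\<^sup>2\<close> would give a function with
  positive Laplacian whose maximum is still attained inside \<open>\<Omega>\<close>, where both pure second
  derivatives are nonpositive.
\<close>

lemma comparison_principle:
  assumes \<Omega>: "open \<Omega>" "bounded \<Omega>"
    and f: "twice_differentiable_on f \<Omega>" "continuous_on (closure \<Omega>) f"
    and g: "twice_differentiable_on g \<Omega>" "continuous_on (closure \<Omega>) g"
    and lap: "\<And>z. z \<in> \<Omega> \<Longrightarrow> laplacian g z \<le> laplacian f z"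
    and bd: "\<And>z. z \<in> frontier \<Omega> \<Longrightarrow> f z \<le> g z"
    and p: "p \<in> \<Omega>"
  shows "f p \<le> g p"
proof (rule ccontr)
  assume "\<not> f p \<le> g p"
  obtain R where R: "R > 0" "\<And>z. z \<in> closure \<Omega> \<Longrightarrow> (norm z)\<^sup>2 \<le> R"
  proof -
    obtain B where B: "B > 0" "\<And>z. z \<in> closure \<Omega> \<Longrightarrow> norm z \<le> B"
      using bounded_closure[OF \<Omega>(2)] unfolding bounded_pos by blast
    then show ?thesis by (intro that[of "B\<^sup>2"]) (auto intro: power_mono)
  qed
  \<comment> \<open>Small enough that \<open>\<epsilon> |z|\<^sup>2\<close> on the frontier cannot make up for the excess at \<open>p\<close>.\<close>
  define \<epsilon> where "\<epsilon> = (f p - g p) / (2 * R)"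
  have \<epsilon>: "\<epsilon> > 0" "\<epsilon> * R < f p - g p"
    using R \<open>\<not> f p \<le> g p\<close> by (auto simp: \<epsilon>_def)
  let ?n = "\<lambda>z::complex. (norm z)\<^sup>2"
  \<comment> \<open>Written with \<open>(- 1) * g\<close> so that linearity of the Laplacian applies twice.\<close>
  define w where "w = (\<lambda>z. (f z + (- 1) * g z) + \<epsilon> * ?n z)"
  have n: "twice_differentiable_on ?n \<Omega>" "\<And>z. z \<in> \<Omega> \<Longrightarrow> laplacian ?n z = 4"
    using derivatives_Re_plus_norm_square(2,4)[where S = \<Omega> and F = "\<lambda>_. 0" and F' = "\<lambda>_. 0"
        and F'' = "\<lambda>_. 0" and c = 1] \<Omega> by simp_all
  note sum = twice_differentiable_on_add_cmult[OF \<Omega>(1)]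
  have w: "twice_differentiable_on w \<Omega>"
    unfolding w_def by (intro sum f g n)
  have lap_w: "laplacian w z > 0" if "z \<in> \<Omega>" for z
  proof -
    have "laplacian w z = (laplacian f z + (- 1) * laplacian g z) + \<epsilon> * laplacian ?n z"
      using that unfolding w_def by (simp only: sum f g n)
    then show ?thesis using lap[OF that] n(2)[OF that] \<epsilon> by simp
  qed
  have "continuous_on (closure \<Omega>) w"
    unfolding w_def by (intro continuous_intros f g)
  moreover have "compact (closure \<Omega>)"
    using \<Omega> by (simp add: compact_closure)
  ultimately obtain q where q: "q \<in> closure \<Omega>" "\<And>z. z \<in> closure \<Omega> \<Longrightarrow> w z \<le> w q"
    using continuous_attains_sup[of "closure \<Omega>" w] p closure_subset by blast
  have "q \<in> \<Omega>"
  proof (rule ccontr)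
    assume "q \<notin> \<Omega>"
    then have "f q \<le> g q"
      using q \<Omega> bd by (simp add: frontier_def interior_open)
    then have "w q \<le> \<epsilon> * R"
      using mult_left_mono[OF R(2)[OF q(1)], of \<epsilon>] \<epsilon> unfolding w_def by linarith
    also have "\<dots> < f p - g p" by (fact \<epsilon>)
    also have "\<dots> \<le> w p" using \<epsilon> by (simp add: w_def)
    finally show False using q(2)[of p] p closure_subset by force
  qed
  have "partial_deriv d (partial_deriv d w) q \<le> 0" if "d \<in> {1, \<i>}" for d
    by (rule pure_second_partial_nonpos_at_local_max[OF \<Omega>(1) \<open>q \<in> \<Omega>\<close>])
      (use w q that \<open>q \<in> \<Omega>\<close> closure_subset in \<open>auto simp: twice_differentiable_on_def\<close>)
  then have "laplacian w q \<le> 0"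
    by (simp add: laplacian_def add_nonpos_nonpos)
  with lap_w[OF \<open>q \<in> \<Omega>\<close>] show False by simp
qed

lemma torsion_function_unique:
  assumes \<Omega>: "open \<Omega>" "bounded \<Omega>" and v: "torsion_function \<Omega> v"
    and u: "twice_differentiable_on u \<Omega>" "continuous_on (closure \<Omega>) u"
    and lap: "\<And>z. z \<in> \<Omega> \<Longrightarrow> laplacian u z = -2"
    and bd: "\<And>z. z \<in> frontier \<Omega> \<Longrightarrow> u z = 0"
    and z: "z \<in> \<Omega>"
  shows "v z = u z"
proof (rule antisym)
  have v': "twice_differentiable_on v \<Omega>" "continuous_on (closure \<Omega>) v"
    using v by (auto simp: torsion_function_def C2_on_def twice_differentiable_on_def)
  show "v z \<le> u z"
    using v by - (rule comparison_principle[OF \<Omega> v' u]; simp_all add: lap bd z torsion_function_def)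
  show "u z \<le> v z"
    using v by - (rule comparison_principle[OF \<Omega> u v']; simp_all add: lap bd z torsion_function_def)
qed

section \<open>The torsion function of the Neumann oval\<close>

definition oval_torsion :: "complex \<Rightarrow> real" where
  "oval_torsion z = Re (csqrt (1 + z\<^sup>2)) - (norm z)\<^sup>2 / 2"

definition slit_plane :: "complex set" where
  "slit_plane = {z. 1 + z\<^sup>2 \<notin> \<real>\<^sub>\<le>\<^sub>0}"

lemma open_slit_plane: "open slit_plane"
proof -
  have "closed ((\<lambda>z::complex. 1 + z\<^sup>2) -` \<real>\<^sub>\<le>\<^sub>0)"
    by (intro continuous_closed_vimage closed_nonpos_Reals_complex continuous_intros)
  moreover have "slit_plane = - ((\<lambda>z::complex. 1 + z\<^sup>2) -` \<real>\<^sub>\<le>\<^sub>0)"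
    by (auto simp: slit_plane_def)
  ultimately show ?thesis using open_Compl by metis
qed

lemma csqrt_one_plus_square_derivs:
  assumes "z \<in> slit_plane"
  shows "((\<lambda>z. csqrt (1 + z\<^sup>2)) has_field_derivative z / csqrt (1 + z\<^sup>2)) (at z)"
    and "((\<lambda>z. z / csqrt (1 + z\<^sup>2)) has_field_derivative 1 / csqrt (1 + z\<^sup>2) ^ 3) (at z)"
proof -
  have z: "1 + z\<^sup>2 \<notin> \<real>\<^sub>\<le>\<^sub>0" using assms by (simp add: slit_plane_def)
  then have s: "csqrt (1 + z\<^sup>2) \<noteq> 0" by auto
  show D: "((\<lambda>z. csqrt (1 + z\<^sup>2)) has_field_derivative z / csqrt (1 + z\<^sup>2)) (at z)"
    by (rule derivative_eq_intros refl z | simp)+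
  have sq: "csqrt (1 + z\<^sup>2) ^ 2 = 1 + z\<^sup>2" by simp
  have "1 / csqrt (1 + z\<^sup>2) ^ 3 =
      (csqrt (1 + z\<^sup>2) - z * (z / csqrt (1 + z\<^sup>2))) / (csqrt (1 + z\<^sup>2) * csqrt (1 + z\<^sup>2))"
    using s sq by (simp add: field_simps power2_eq_square power3_eq_cube)
  then show "((\<lambda>z. z / csqrt (1 + z\<^sup>2)) has_field_derivative 1 / csqrt (1 + z\<^sup>2) ^ 3) (at z)"
    using DERIV_divide[OF DERIV_ident D s] by simp
qed

lemma oval_torsion_derivs:
  shows "twice_differentiable_on oval_torsion slit_plane"
    and "z \<in> slit_plane \<Longrightarrow> (oval_torsion has_derivative
      (\<lambda>h. Re (z / csqrt (1 + z\<^sup>2) * h) - z \<bullet> h)) (at z)"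
    and "z \<in> slit_plane \<Longrightarrow> partial_deriv e (partial_deriv d oval_torsion) z =
      Re (1 / csqrt (1 + z\<^sup>2) ^ 3 * e * d) - e \<bullet> d"
    and "z \<in> slit_plane \<Longrightarrow> laplacian oval_torsion z = -2"
proof -
  have eq: "oval_torsion = (\<lambda>z. Re (csqrt (1 + z\<^sup>2)) + (-1/2) * (norm z)\<^sup>2)"
    by (simp add: oval_torsion_def fun_eq_iff)
  note derivs = derivatives_Re_plus_norm_square[where S = slit_plane and F = "\<lambda>z. csqrt (1 + z\<^sup>2)"
      and F' = "\<lambda>z. z / csqrt (1 + z\<^sup>2)" and F'' = "\<lambda>z. 1 / csqrt (1 + z\<^sup>2) ^ 3"
      and c = "-1/2", folded eq, OF open_slit_plane csqrt_one_plus_square_derivs]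
  show "twice_differentiable_on oval_torsion slit_plane"
    and "z \<in> slit_plane \<Longrightarrow> (oval_torsion has_derivative
      (\<lambda>h. Re (z / csqrt (1 + z\<^sup>2) * h) - z \<bullet> h)) (at z)"
    and "z \<in> slit_plane \<Longrightarrow> partial_deriv e (partial_deriv d oval_torsion) z =
      Re (1 / csqrt (1 + z\<^sup>2) ^ 3 * e * d) - e \<bullet> d"
    and "z \<in> slit_plane \<Longrightarrow> laplacian oval_torsion z = -2"
    using derivs by simp_all
qed

text \<open>
  At a critical point \<open>z / s = cnj z\<close>, where \<open>s\<^sup>2 = 1 + z\<^sup>2\<close>.  Squaring gives
  \<open>z\<^sup>2 - (cnj z)\<^sup>2 = |z|\<^sup>4\<close>, with an imaginary left and a real right side.
\<close>

lemma oval_torsion_critical_point: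
  assumes z: "z \<in> slit_plane" and max: "\<forall>\<^sub>F w in nhds z. oval_torsion w \<le> oval_torsion z"
  shows "z = 0"
proof -
  define s where "s = csqrt (1 + z\<^sup>2)"
  have s: "s \<noteq> 0" "s\<^sup>2 = 1 + z\<^sup>2"
    using z by (auto simp: s_def slit_plane_def)
  obtain r where r: "r > 0" "\<forall>w\<in>ball z r. oval_torsion w \<le> oval_torsion z"
    using max unfolding eventually_nhds_metric by (auto simp: dist_commute)
  have "(\<lambda>h. Re (z / s * h) - z \<bullet> h) = (\<lambda>h. 0)"
    using differential_zero_maxmin[of z "ball z r" oval_torsion] r
      oval_torsion_derivs(2)[OF z] by (simp add: s_def)
  then have "Re (z / s * 1) - z \<bullet> 1 = 0" "Re (z / s * \<i>) - z \<bullet> \<i> = 0"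
    by metis+
  then have "z / s = cnj z"
    by (simp add: complex_eq_iff inner_complex_def del: times_divide_eq_left)
  then have "z = s * cnj z" using s by (simp add: field_simps)
  then have "z\<^sup>2 = (1 + z\<^sup>2) * (cnj z)\<^sup>2" using s by (metis power_mult_distrib)
  also have "\<dots> = (cnj z)\<^sup>2 + (z * cnj z)\<^sup>2" by (simp add: algebra_simps)
  finally have "Re (z\<^sup>2) = Re ((cnj z)\<^sup>2) + Re ((z * cnj z)\<^sup>2)" by simp
  moreover have "Re ((cnj z)\<^sup>2) = Re (z\<^sup>2)"
    by (simp flip: complex_cnj_power)
  moreover have "(z * cnj z)\<^sup>2 = of_real (((norm z)\<^sup>2)\<^sup>2)"
    by (simp only: complex_norm_square[symmetric] of_real_power[symmetric])
  ultimately have "((norm z)\<^sup>2)\<^sup>2 = 0"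
    by (simp only: Re_complex_of_real)
  then show ?thesis by simp
qed

text \<open>
  Since \<open>z\<^sup>2 = (s - 1) * (s + 1)\<close>, the claim is \<open>2 * (Re s - 1) \<le> |s - 1| * |s + 1|\<close>, and
  \<open>|s + 1| \<ge> 2\<close> as soon as \<open>Re s > 1\<close>.
\<close>

lemma oval_torsion_le: "oval_torsion z \<le> oval_torsion 0"
proof -
  define s where "s = csqrt (1 + z\<^sup>2)"
  have "z\<^sup>2 = (s - 1) * (s + 1)"
    by (simp add: s_def algebra_simps flip: power2_eq_square)
  then have n: "(norm z)\<^sup>2 = norm (s - 1) * norm (s + 1)"
    by (metis norm_mult norm_power)
  have "2 * (Re s - 1) \<le> norm (s - 1) * norm (s + 1)"
  proof (cases "Re s \<le> 1")
    case True
    then show ?thesis by (smt (verit) mult_nonneg_nonneg norm_ge_zero)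
  next
    case False
    then have "Re s - 1 \<le> norm (s - 1)" "2 \<le> norm (s + 1)"
      using complex_Re_le_cmod[of "s - 1"] complex_Re_le_cmod[of "s + 1"] by auto
    from mult_mono[OF this] show ?thesis by (simp add: mult.commute)
  qed
  then show ?thesis by (simp add: oval_torsion_def n s_def)
qed

lemma neumann_oval_region_iff: "z \<in> neumann_oval_region a \<longleftrightarrow>
    (norm z)^4 \<le> a\<^sup>2 * (norm z)\<^sup>2 + 4 * (Re z)\<^sup>2"
proof -
  have "(norm z)^4 = ((norm z)\<^sup>2)\<^sup>2" by simp
  then show ?thesis by (simp only: neumann_oval_region_def mem_Collect_eq cmod_power2)
qed

lemma closed_neumann_oval_region: "closed (neumann_oval_region a)"
  unfolding neumann_oval_region_def
  by (intro closed_Collect_le continuous_on_add continuous_on_mult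
      continuous_on_power continuous_on_const continuous_on_Re continuous_on_Im continuous_on_id)

context
  fixes a :: real
  assumes a_def: "a = sqrt (2 / (1 + sqrt 2))"
begin

lemma a_square: "a\<^sup>2 = 2 * sqrt 2 - 2"
proof -
  have "a\<^sup>2 = 2 / (1 + sqrt 2)" by (simp add: a_def)
  also have "\<dots> = 2 * sqrt 2 - 2"
    by (simp add: field_simps add_pos_pos add_nonneg_eq_0_iff)
  finally show ?thesis .
qed

lemma a_bounds: "0 < a" "a\<^sup>2 < 1"
proof -
  show "0 < a" by (auto simp: a_def intro!: divide_pos_pos add_pos_pos)
  have "sqrt 2 < 3/2" by (rule real_less_lsqrt) (auto simp: power2_eq_square)
  then show "a\<^sup>2 < 1" by (simp add: a_square)
qed

lemma bounded_region: "bounded (neumann_oval_region a)"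
proof (rule boundedI)
  fix z assume "z \<in> neumann_oval_region a"
  then have "(norm z)\<^sup>2 * (norm z)\<^sup>2 \<le> a\<^sup>2 * (norm z)\<^sup>2 + 4 * (Re z)\<^sup>2"
    by (simp add: neumann_oval_region_iff power2_eq_square power4_eq_xxxx mult.assoc)
  also have "\<dots> \<le> 1 * (norm z)\<^sup>2 + 4 * (norm z)\<^sup>2"
    using a_bounds by (intro add_mono mult_right_mono) (auto simp: cmod_power2)
  finally have "(norm z)\<^sup>2 * (norm z)\<^sup>2 \<le> 5 * (norm z)\<^sup>2" by linarith
  then have "(norm z)\<^sup>2 \<le> 5 \<or> z = 0"
    by (subst (asm) mult_le_cancel_right) auto
  then have "(norm z)\<^sup>2 \<le> 3\<^sup>2" by auto
  then show "norm z \<le> 3" by (rule power2_le_imp_le) simp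
qed

lemma ball_subset_region: "ball 0 a \<subseteq> neumann_oval_region a"
proof
  fix z :: complex assume "z \<in> ball 0 a"
  then have "(norm z)\<^sup>2 * (norm z)\<^sup>2 \<le> a\<^sup>2 * (norm z)\<^sup>2"
    by (intro mult_right_mono power_mono) auto
  then show "z \<in> neumann_oval_region a"
    by (simp add: neumann_oval_region_iff power2_eq_square power4_eq_xxxx mult.assoc add_increasing2)
qed

text \<open>
  The slits are the points \<open>i y\<close> with \<open>|y| \<ge> 1\<close>, while the oval meets the imaginary axis only where
  \<open>|y| \<le> a < 1\<close>.
\<close>

lemma region_subset_slit_plane: "neumann_oval_region a \<subseteq> slit_plane"
proof (rule subsetI, rule ccontr)
  fix z assume z: "z \<in> neumann_oval_region a" "z \<notin> slit_plane"
  then have im: "Im (z\<^sup>2) = 0" and re: "Re (z\<^sup>2) \<le> -1"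
    by (auto simp: slit_plane_def complex_nonpos_Reals_iff)
  from im have "Re z = 0 \<or> Im z = 0" by (simp add: Im_power2)
  moreover have "(Im z)\<^sup>2 \<ge> (Re z)\<^sup>2 + 1"
    using re by (simp add: Re_power2)
  moreover have "(Im z)\<^sup>2 \<ge> 1"
    using calculation(2) zero_le_power2[of "Re z"] by linarith
  ultimately have x: "Re z = 0" and y: "(Im z)\<^sup>2 \<ge> 1"
    by auto
  have "(Im z)\<^sup>2 * (Im z)\<^sup>2 \<le> a\<^sup>2 * (Im z)\<^sup>2"
    using z x by (simp add: neumann_oval_region_def power2_eq_square)
  with y have "(Im z)\<^sup>2 \<le> a\<^sup>2" by (subst (asm) mult_le_cancel_right) auto
  with y a_bounds show False by simp
qed

text \<open>
  By the half-angle formula, \<open>Re (sqrt w)\<^sup>2 = (|w| + Re w) / 2\<close>.  For \<open>w = 1 + z\<^sup>2\<close> on the curve,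
  \<open>|w|\<^sup>2\<close> is a quadratic polynomial in \<open>\<rho> = |z|\<^sup>2\<close>, and \<open>(a\<^sup>2 + 2)\<^sup>2 = 8\<close> makes it a perfect square.
\<close>

lemma oval_torsion_eq_0:
  assumes eq: "(norm z)^4 = a\<^sup>2 * (norm z)\<^sup>2 + 4 * (Re z)\<^sup>2" and "z \<noteq> 0"
  shows "oval_torsion z = 0"
proof -
  define \<rho> where "\<rho> = (norm z)\<^sup>2"
  have \<rho>: "\<rho> = (Re z)\<^sup>2 + (Im z)\<^sup>2" by (simp add: \<rho>_def cmod_power2)
  have eq': "\<rho>\<^sup>2 = a\<^sup>2 * \<rho> + 4 * (Re z)\<^sup>2"
    using eq by (simp add: \<rho>_def)
  have "\<rho> > 0" using \<open>z \<noteq> 0\<close> by (simp add: \<rho>_def)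
  have "a\<^sup>2 * \<rho> \<le> \<rho> * \<rho>" using eq' by (simp add: power2_eq_square[of \<rho>])
  then have "a\<^sup>2 \<le> \<rho>" using \<open>\<rho> > 0\<close> by simp
  have Re: "Re (1 + z\<^sup>2) = 1 + 2 * (Re z)\<^sup>2 - \<rho>" by (simp add: \<rho> Re_power2)
  have quad: "(a\<^sup>2 + 2)\<^sup>2 = 8" "2 \<le> (a\<^sup>2 + 2) * a\<^sup>2"
  proof -
    show "(a\<^sup>2 + 2)\<^sup>2 = 8" by (simp add: a_square power_mult_distrib)
    have "sqrt 2 \<le> 3/2" by (rule real_le_lsqrt) (auto simp: power2_eq_square)
    then show "2 \<le> (a\<^sup>2 + 2) * a\<^sup>2" by (simp add: a_square algebra_simps)
  qed
  \<comment> \<open>This fixes the sign of the root of the perfect square; at the excluded point \<open>0\<close>, which also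
    lies on the curve, it is the other one.\<close>
  have nonneg: "(a\<^sup>2 + 2) / 2 * \<rho> - 1 \<ge> 0"
  proof -
    have "2 \<le> (a\<^sup>2 + 2) * a\<^sup>2" by (fact quad)
    also have "\<dots> \<le> (a\<^sup>2 + 2) * \<rho>"
      using \<open>a\<^sup>2 \<le> \<rho>\<close> by (intro mult_left_mono) auto
    finally show ?thesis by simp
  qed
  have "(norm (1 + z\<^sup>2))\<^sup>2 = (1 + (2 * (Re z)\<^sup>2 - \<rho>))\<^sup>2 + (2 * Re z * Im z)\<^sup>2"
    by (simp add: cmod_power2 \<rho> Re_power2 Im_power2)
  also have "\<dots> = 1 + 2 * (2 * (Re z)\<^sup>2 - \<rho>) + \<rho>\<^sup>2"
    unfolding \<rho> by algebra
  also have "\<dots> = ((a\<^sup>2 + 2) / 2 * \<rho> - 1)\<^sup>2"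
  proof -
    have "((a\<^sup>2 + 2) / 2 * \<rho> - 1)\<^sup>2 = (a\<^sup>2 + 2)\<^sup>2 / 4 * \<rho>\<^sup>2 - (a\<^sup>2 + 2) * \<rho> + 1"
      by (simp add: power2_eq_square field_simps)
    then show ?thesis using eq' unfolding quad(1) by (simp add: algebra_simps)
  qed
  finally have norm: "norm (1 + z\<^sup>2) = (a\<^sup>2 + 2) / 2 * \<rho> - 1"
    using nonneg by (simp add: power2_eq_iff_nonneg)
  have "(norm (1 + z\<^sup>2) + Re (1 + z\<^sup>2)) / 2 = (\<rho> / 2)\<^sup>2"
    using eq' unfolding norm Re by (simp add: field_simps power2_eq_square)
  then have "Re (csqrt (1 + z\<^sup>2)) = \<rho> / 2"
    using \<open>\<rho> > 0\<close> by (simp add: csqrt.sel)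
  then show ?thesis by (simp add: oval_torsion_def \<rho>_def)
qed

end

lemma rank_diag_one: "rank (vector [vector [0, 0], vector [0, -2]] :: real^2^2) = 1"
proof -
  let ?A = "vector [vector [0, 0], vector [0, -2]] :: real^2^2"
  let ?w = "vector [0, -2] :: real^2"
  have "row 1 ?A = 0" "row 2 ?A = ?w"
    by (simp_all add: row_def vec_eq_iff forall_2)
  moreover have "rows ?A = {row 1 ?A, row 2 ?A}"
    by (auto simp: rows_def UNIV_2)
  ultimately have rows: "rows ?A = {0, ?w}"
    by simp
  have "?w \<noteq> 0"
    by (simp add: vec_eq_iff forall_2)
  then have "dim {?w} = 1"
    by (simp add: dim_eq_card_independent)
  have "rank ?A = dim (span {0, ?w})"
    unfolding row_rank_def rows by (rule dim_span[symmetric])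
  also have "\<dots> = dim {?w}"
    unfolding span_insert_0 by (rule dim_span)
  finally show ?thesis using \<open>dim {?w} = 1\<close> by simp
qed

theorem theorem1p5:
  fixes a :: real and \<Omega> :: "complex set" and v :: "complex \<Rightarrow> real"
  assumes "a = sqrt (2 / (1 + sqrt 2))"
    and "\<Omega> = interior (neumann_oval_region a)"
    and "torsion_function \<Omega> v"
  shows "local_maxima \<Omega> v = {0}
    \<and> hessian v 0 = vector [vector [0, 0], vector [0, -2]]
    \<and> rank (hessian v 0) = 1"
proof -
  note a = assms(1)
  let ?R = "neumann_oval_region a"
  have open_\<Omega>: "open \<Omega>" and \<Omega>_R: "\<Omega> \<subseteq> ?R" and cl_R: "closure \<Omega> \<subseteq> ?R"
    unfolding assms(2)
    by (intro open_interior interior_subset closure_minimal closed_neumann_oval_region)+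
  have "0 \<in> \<Omega>"
    using interior_maximal[OF ball_subset_region[OF a] open_ball] a_bounds(1)[OF a]
    by (auto simp: assms(2))
  have slit: "z \<in> slit_plane" if "z \<in> closure \<Omega>" for z
    using that cl_R region_subset_slit_plane[OF a] by blast
  have slit_\<Omega>: "z \<in> slit_plane" if "z \<in> \<Omega>" for z
    using that slit closure_subset by blast
  have v_eq: "v z = oval_torsion z" if "z \<in> \<Omega>" for z
  proof (rule torsion_function_unique[OF open_\<Omega> _ assms(3) _ _ _ _ that])
    show "bounded \<Omega>"
      using bounded_region[OF a] \<Omega>_R bounded_subset by blast
    show "twice_differentiable_on oval_torsion \<Omega>"
      using oval_torsion_derivs(1) slit_\<Omega> by (auto simp: twice_differentiable_on_def)
    show "continuous_on (closure \<Omega>) oval_torsion"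
      using slit oval_torsion_derivs(2) has_derivative_continuous
      by (blast intro: continuous_at_imp_continuous_on)
    show "laplacian oval_torsion z = -2" if "z \<in> \<Omega>" for z
      using that slit_\<Omega> oval_torsion_derivs(4) by blast
    show "oval_torsion z = 0" if "z \<in> frontier \<Omega>" for z
    proof (rule oval_torsion_eq_0[OF a])
      have z: "z \<in> ?R" "z \<notin> \<Omega>"
        using that open_\<Omega> cl_R by (auto simp: frontier_def interior_open)
      show "z \<noteq> 0" using z \<open>0 \<in> \<Omega>\<close> by auto
      let ?U = "{z. norm z ^ 4 < a\<^sup>2 * (norm z)\<^sup>2 + 4 * (Re z)\<^sup>2}"
      have "open ?U" by (intro open_Collect_less continuous_intros)
      moreover have "?U \<subseteq> ?R" by (auto simp: neumann_oval_region_iff)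
      ultimately have "?U \<subseteq> \<Omega>" by (simp add: assms(2) interior_maximal)
      then show "norm z ^ 4 = a\<^sup>2 * (norm z)\<^sup>2 + 4 * (Re z)\<^sup>2"
        using z by (force simp: neumann_oval_region_iff)
    qed
  qed
  have maxima: "local_maxima \<Omega> v = {0}"
  proof (rule antisym; rule subsetI)
    fix z assume "z \<in> local_maxima \<Omega> v"
    then have z: "z \<in> \<Omega>" "\<forall>\<^sub>F w in nhds z. v w \<le> v z"
      by (auto simp: local_maxima_def)
    have "\<forall>\<^sub>F w in nhds z. w \<in> \<Omega>"
      using open_\<Omega> z(1) by (rule eventually_nhds_in_open)
    with z(2) have "\<forall>\<^sub>F w in nhds z. oval_torsion w \<le> oval_torsion z"
      by eventually_elim (use z(1) v_eq in auto)
    then show "z \<in> {0}"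
      using oval_torsion_critical_point slit_\<Omega> z(1) by blast
  next
    fix z :: complex assume "z \<in> {0}"
    have "\<forall>\<^sub>F w in nhds 0. w \<in> \<Omega>"
      using open_\<Omega> \<open>0 \<in> \<Omega>\<close> by (rule eventually_nhds_in_open)
    then have "\<forall>\<^sub>F w in nhds 0. v w \<le> v 0"
      by eventually_elim (use \<open>0 \<in> \<Omega>\<close> v_eq oval_torsion_le in auto)
    with \<open>z \<in> {0}\<close> \<open>0 \<in> \<Omega>\<close> show "z \<in> local_maxima \<Omega> v"
      by (simp add: local_maxima_def)
  qed
  have "partial_deriv e (partial_deriv d v) 0 = partial_deriv e (partial_deriv d oval_torsion) 0" for d e
    by (intro partial_deriv_cong_open[OF open_\<Omega>] \<open>0 \<in> \<Omega>\<close> v_eq)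
  then have "partial_deriv e (partial_deriv d v) 0 = Re (e * d) - e \<bullet> d" for d e
    using oval_torsion_derivs(3) slit_\<Omega>[OF \<open>0 \<in> \<Omega>\<close>] by simp
  then have "hessian v 0 = vector [vector [0, 0], vector [0, -2]]"
    by (simp add: hessian_def inner_complex_def)
  with maxima show ?thesis by (simp add: rank_diag_one)
qed

end
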